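(* Let $d\ge 1$ and let $\Delta=\{x\in\mathbb{R}^d : x_i\ge 0 \ (i=1,\dots,d),\ \sum_{i=1}^d x_i\le 1\}$ be the standard simplex. Then for every $x\in\operatorname{int}\Delta$ and every $y\in\mathbb{R}^d$ with Euclidean norm $|y|_2=1$, $$D_y^{+}V_{\Delta}(x)=\frac{1}{E(\Delta,x,y)}.$$ That is, the pluripotential-theoretic estimate $|\langle Dp(x),y\rangle|\le n\,D_y^{+}V_\Delta(x)\sqrt{\|p\|_{C(\Delta)}^2-p(x)^2}$ and the inscribed ellipse estimate $|\langle Dp(x),y\rangle|\le \frac{n}{E(\Delta,x,y)}\sqrt{\|p\|_{C(\Delta)}^2-p(x)^2}$, for real polynomials $p$ of degree at most $n$, have identical right-hand sides.
   Context: For a bounded set $E\subset\mathbb{C}^d$, the Zaharjuta-Siciak extremal function $V_E$ is defined by $V_E=0$ on $E$ and, for $z\notin E$, $$V_E(z)=\sup\Big\{\tfrac1n\log|p(z)| : n\in\mathbb{N},\ 0\ne p \text{ a polynomial on } \mathbb{C}^d \text{ of degree at most } n,\ \|p\|_E\le 1\Big\},$$ where $\|p\|_E=\sup_E|p|$. A set $E\subset\mathbb{R}^d$ is regarded as a subset of $\mathbb{C}^d=\mathbb{R}^d+i\mathbb{R}^d$. For $E\subset\mathbb{R}^d$, $x\in\operatorname{int}E$ and $y\in\mathbb{R}^d$, put $$D_y^{+}V_E(x)=\liminf_{\epsilon\to0+}\frac{V_E(x+i\epsilon y)}{\epsilon}.$$ For $K\subset\mathbb{R}^d$, $x\in K$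 and $y\in\mathbb{R}^d$, the best ellipse constant is $$E(K,x,y)=\sup\{b : \text{there is } a\in\mathbb{R}^d \text{ with } \cos t\, a+b\sin t\, y+x-a\in K \text{ for all } t\in[-\pi,\pi)\}.$$ *)

theory Defs
  imports "HOL-Analysis.Analysis"
begin

text \<open>
  A polynomial in the coordinates of \<open>'a ^ 'n\<close> is represented by the function it induces.
  Over the infinite fields \<open>real\<close> and \<open>complex\<close> this function determines the coefficients,
  so the zero polynomial is the constant function \<open>0\<close>.
\<close>

definition monomials_upto :: "nat \<Rightarrow> ('n::finite \<Rightarrow> nat) set" where
  "monomials_upto n = {\<alpha>. (\<Sum>i\<in>UNIV. \<alpha> i) \<le> n}"

lemma finite_monomials_upto: "finite (monomials_upto n :: ('n::finite \<Rightarrow> nat) set)"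
proof (rule finite_subset)
  show "(monomials_upto n :: ('n \<Rightarrow> nat) set) \<subseteq> Pi\<^sub>E UNIV (\<lambda>_. {..n})"
  proof
    fix \<alpha> :: "'n \<Rightarrow> nat"
    assume "\<alpha> \<in> monomials_upto n"
    then have *: "(\<Sum>i\<in>UNIV. \<alpha> i) \<le> n"
      by (simp add: monomials_upto_def)
    have "\<alpha> i \<le> n" for i
      using member_le_sum[of i UNIV \<alpha>] * by simp
    then show "\<alpha> \<in> Pi\<^sub>E UNIV (\<lambda>_. {..n})"
      by (simp add: PiE_iff)
  qed
  show "finite (Pi\<^sub>E (UNIV :: 'n set) (\<lambda>_. {..n}))"
    by (rule finite_PiE) simp_all
qed

definition polynomial_upto :: "nat \<Rightarrow> ('a::field ^ 'n::finite \<Rightarrow> 'a) \<Rightarrow> bool" where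
  "polynomial_upto n p \<longleftrightarrow>
     (\<exists>c. \<forall>z. p z = (\<Sum>\<alpha>\<in>monomials_upto n. c \<alpha> * (\<Prod>i\<in>UNIV. (z $ i) ^ \<alpha> i)))"

definition sup_norm :: "'b set \<Rightarrow> ('b \<Rightarrow> 'a::real_normed_vector) \<Rightarrow> ereal" where
  "sup_norm E p = (SUP z\<in>E. ereal (norm (p z)))"

text \<open>The library has \<open>ln 0 = 0\<close>; here \<open>log 0 = -\<infinity>\<close> is needed.\<close>

definition log_abs :: "complex \<Rightarrow> ereal" where
  "log_abs w = (if w = 0 then -\<infinity> else ereal (ln (cmod w)))"

definition siciak :: "(complex ^ 'n::finite) set \<Rightarrow> complex ^ 'n \<Rightarrow> ereal" where
  "siciak E z = (if z \<in> E then 0 else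
     Sup {log_abs (p z) / ereal (real n) | n p.
            n \<ge> 1 \<and> polynomial_upto n p \<and> p \<noteq> (\<lambda>_. 0) \<and> sup_norm E p \<le> 1})"

definition cvec :: "real ^ 'n \<Rightarrow> complex ^ 'n::finite" where
  "cvec x = (\<chi> i. complex_of_real (x $ i))"

definition siciak_deriv :: "(real ^ 'n::finite) set \<Rightarrow> real ^ 'n \<Rightarrow> real ^ 'n \<Rightarrow> ereal" where
  "siciak_deriv E y x =
     Liminf (at_right 0)
       (\<lambda>\<epsilon>. siciak (cvec ` E) (cvec x + (\<i> * complex_of_real \<epsilon>) *s cvec y) / ereal \<epsilon>)"

definition best_ellipse :: "(real ^ 'n::finite) set \<Rightarrow> real ^ 'n \<Rightarrow> real ^ 'n \<Rightarrow> ereal" where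
  "best_ellipse K x y =
     Sup {ereal b | b. \<exists>a. \<forall>t\<in>{-pi..<pi}. cos t *\<^sub>R a + (b * sin t) *\<^sub>R y + x - a \<in> K}"

definition std_simplex :: "(real ^ 'n::finite) set" where
  "std_simplex = {x. (\<forall>i. 0 \<le> x $ i) \<and> (\<Sum>i\<in>UNIV. x $ i) \<le> 1}"

end

theory Submission
  imports Defs "HOL-Complex_Analysis.Conformal_Mappings"
begin

text \<open>
  Write \<open>x\<^sub>0 = 1 - \<Sum>x\<^sub>i\<close>, \<open>y\<^sub>0 = - \<Sum>y\<^sub>i\<close> and \<open>S = \<Sum>y\<^sub>j\<^sup>2 / x\<^sub>j\<close>, the sum including \<open>j = 0\<close>;
  both sides of the identity are \<open>sqrt S\<close>.

  If an ellipse through \<open>x\<close> with half axis \<open>b y\<close> lies in a convex set \<open>K\<close>, the maximum principle for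
  \<open>\<zeta>^n p(f \<zeta>)\<close>, where \<open>f\<close> is the complexified ellipse, gives \<open>D\<^sub>y V\<^sub>K(x) \<le> 1 / b\<close>.
  In the simplex \<open>b = 1 / sqrt S\<close> is attained, with \<open>a\<^sub>j = (x\<^sub>j\<^sup>2 - b\<^sup>2 y\<^sub>j\<^sup>2) / (2 x\<^sub>j)\<close>.

  For the converse \<open>D\<^sub>y V(x) \<ge> sqrt S\<close>, put \<open>z\<^sub>j = w\<^sub>j\<^sup>2\<close>, which turns the simplex into the unit sphere.
  For a real unit vector \<open>u\<close>, the average of the Chebyshev polynomials \<open>T\<close> of degree \<open>2n\<close> at
  \<open>\<Sum>\<plusminus>u\<^sub>j w\<^sub>j\<close> over all choices of signs is bounded by 1 on the sphere and is a polynomial of degree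
  \<open>n\<close> in \<open>z\<close>. If \<open>n\<close> is chosen by simultaneous Diophantine approximation, the terms do not cancel, so
  each of them bounds \<open>V(z)\<close> from below. The choice \<open>u\<^sub>j = y\<^sub>j / sqrt (S x\<^sub>j)\<close> gives the value \<open>sqrt S\<close>.
\<close>

subsection \<open>Polynomials in several variables\<close>

lemma polynomial_upto_sum:
  assumes "\<And>i. i \<in> I \<Longrightarrow> polynomial_upto n (p i)"
  shows "polynomial_upto n (\<lambda>z. \<Sum>i\<in>I. p i z)"
proof -
  obtain c where c: "p i z = (\<Sum>\<alpha>\<in>monomials_upto n. c i \<alpha> * (\<Prod>k\<in>UNIV. (z $ k) ^ \<alpha> k))" if "i \<in> I" for i z
    using assms unfolding polynomial_upto_def by metis
  have "(\<Sum>i\<in>I. p i z) = (\<Sum>\<alpha>\<in>monomials_upto n. (\<Sum>i\<in>I. c i \<alpha>) * (\<Prod>k\<in>UNIV. (z $ k) ^ \<alpha> k))" for z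
    by (simp add: c sum_distrib_right sum.swap[of _ I])
  then show ?thesis
    unfolding polynomial_upto_def by (intro exI[of _ "\<lambda>\<alpha>. \<Sum>i\<in>I. c i \<alpha>"]) auto
qed

lemma polynomial_upto_cmult:
  assumes "polynomial_upto n p"
  shows "polynomial_upto n (\<lambda>z. a * p z)"
proof -
  obtain c where "\<And>z. p z = (\<Sum>\<alpha>\<in>monomials_upto n. c \<alpha> * (\<Prod>k\<in>UNIV. (z $ k) ^ \<alpha> k))"
    using assms unfolding polynomial_upto_def by metis
  then show ?thesis
    unfolding polynomial_upto_def
    by (intro exI[of _ "\<lambda>\<alpha>. a * c \<alpha>"]) (simp add: sum_distrib_left mult.assoc)
qed

lemma polynomial_upto_monomial:
  assumes "\<alpha> \<in> monomials_upto n"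
  shows "polynomial_upto n (\<lambda>z :: 'a::field ^ 'n::finite. \<Prod>i\<in>UNIV. (z $ i) ^ \<alpha> i)"
proof -
  have "(\<Prod>i\<in>UNIV. (z $ i) ^ \<alpha> i) = (\<Sum>\<beta>\<in>monomials_upto n.
      (if \<beta> = \<alpha> then 1 else 0) * (\<Prod>i\<in>UNIV. (z $ i) ^ \<beta> i))" for z :: "'a ^ 'n"
  proof -
    have "(\<Sum>\<beta>\<in>monomials_upto n. (if \<beta> = \<alpha> then 1 else 0) * (\<Prod>i\<in>UNIV. (z $ i) ^ \<beta> i)) =
      (\<Sum>\<beta>\<in>monomials_upto n. if \<beta> = \<alpha> then \<Prod>i\<in>UNIV. (z $ i) ^ \<beta> i else 0)"
      by (rule sum.cong) simp_all
    then show ?thesis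
      using assms by (simp only: sum.delta finite_monomials_upto if_True)
  qed
  then show ?thesis
    unfolding polynomial_upto_def by (intro exI[of _ "\<lambda>\<beta>. if \<beta> = \<alpha> then 1 else 0"] allI)
qed

lemma polynomial_upto_mult:
  assumes "polynomial_upto m p" and "polynomial_upto n q"
  shows "polynomial_upto (m + n) (\<lambda>z. p z * q z)"
proof -
  obtain c where p: "\<And>z. p z = (\<Sum>\<alpha>\<in>monomials_upto m. c \<alpha> * (\<Prod>k\<in>UNIV. (z $ k) ^ \<alpha> k))"
    using assms(1) unfolding polynomial_upto_def by metis
  obtain d where q: "\<And>z. q z = (\<Sum>\<alpha>\<in>monomials_upto n. d \<alpha> * (\<Prod>k\<in>UNIV. (z $ k) ^ \<alpha> k))"
    using assms(2) unfolding polynomial_upto_def by metis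
  have "p z * q z = (\<Sum>\<alpha>\<in>monomials_upto m. \<Sum>\<beta>\<in>monomials_upto n.
      c \<alpha> * d \<beta> * (\<Prod>k\<in>UNIV. (z $ k) ^ (\<alpha> k + \<beta> k)))" for z
    by (simp add: p q sum_product power_add prod.distrib mult_ac)
  moreover have "polynomial_upto (m + n) (\<lambda>z. c \<alpha> * d \<beta> * (\<Prod>k\<in>UNIV. (z $ k) ^ (\<alpha> k + \<beta> k)))"
    if "\<alpha> \<in> monomials_upto m" and "\<beta> \<in> monomials_upto n" for \<alpha> \<beta>
    using that
    by (intro polynomial_upto_cmult polynomial_upto_monomial[of "\<lambda>k. \<alpha> k + \<beta> k"])
      (simp add: monomials_upto_def sum.distrib add_mono)
  ultimately show ?thesis
    by (simp add: polynomial_upto_sum)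
qed

lemma polynomial_upto_mono:
  assumes "polynomial_upto m p" and "m \<le> n"
  shows "polynomial_upto n p"
proof -
  obtain c where c: "\<And>z. p z = (\<Sum>\<alpha>\<in>monomials_upto m. c \<alpha> * (\<Prod>k\<in>UNIV. (z $ k) ^ \<alpha> k))"
    using assms unfolding polynomial_upto_def by metis
  have "polynomial_upto n (\<lambda>z. \<Sum>\<alpha>\<in>monomials_upto m. c \<alpha> * (\<Prod>k\<in>UNIV. (z $ k) ^ \<alpha> k))"
    by (intro polynomial_upto_sum polynomial_upto_cmult polynomial_upto_monomial)
      (use assms in \<open>auto simp: monomials_upto_def\<close>)
  then show ?thesis
    unfolding c[symmetric] .
qed

lemma polynomial_upto_const: "polynomial_upto n (\<lambda>_. a)"
proof -
  have "polynomial_upto n (\<lambda>z. a * (\<Prod>i\<in>UNIV. (z $ i) ^ 0))"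
    by (intro polynomial_upto_cmult polynomial_upto_monomial) (simp add: monomials_upto_def)
  then show ?thesis
    by simp
qed

lemma polynomial_upto_coord: "polynomial_upto 1 (\<lambda>z. z $ i)"
proof -
  have "polynomial_upto 1 (\<lambda>z. \<Prod>k\<in>UNIV. (z $ k) ^ (if k = i then 1 else 0))"
    by (intro polynomial_upto_monomial) (simp add: monomials_upto_def)
  then show ?thesis
    by (simp add: if_distrib[of "\<lambda>k. _ ^ k"] cong: if_cong)
qed

lemma polynomial_upto_power:
  assumes "polynomial_upto n p"
  shows "polynomial_upto (n * k) (\<lambda>z. p z ^ k)"
proof (induction k)
  case (Suc k)
  then show ?case
    using polynomial_upto_mult[OF assms Suc] by simp
qed (simp add: polynomial_upto_const)

lemma polynomial_upto_diff:
  assumes "polynomial_upto n p" and "polynomial_upto n q"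
  shows "polynomial_upto n (\<lambda>z. p z - q z)"
proof -
  have "polynomial_upto n (\<lambda>z. \<Sum>b\<in>UNIV. if b then p z else - 1 * q z)"
  proof (rule polynomial_upto_sum)
    show "polynomial_upto n (\<lambda>z. if b then p z else - 1 * q z)" for b
      using assms polynomial_upto_cmult[OF assms(2), of "- 1"] by (cases b) simp_all
  qed
  then show ?thesis
    by (simp add: UNIV_bool)
qed

subsection \<open>Barycentric coordinates\<close>

text \<open>The index \<open>None\<close> stands for the coordinate \<open>z\<^sub>0 = 1 - \<Sum>z\<^sub>i\<close>.\<close>

definition barycentric :: "'a::comm_ring_1 ^ 'n::finite \<Rightarrow> 'n option \<Rightarrow> 'a" where
  "barycentric z j = (case j of None \<Rightarrow> 1 - (\<Sum>i\<in>UNIV. z $ i) | Some i \<Rightarrow> z $ i)"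

lemma polynomial_upto_barycentric: "polynomial_upto 1 (\<lambda>z. barycentric z j)"
  unfolding barycentric_def
  by (cases j) (auto intro!: polynomial_upto_diff polynomial_upto_const polynomial_upto_sum
    polynomial_upto_coord[unfolded One_nat_def])

lemma sum_UNIV_option: "(\<Sum>j\<in>UNIV. f j) = f None + (\<Sum>i\<in>UNIV. f (Some i))"
  for f :: "'n::finite option \<Rightarrow> 'a::comm_monoid_add"
  by (simp add: UNIV_option_conv sum.reindex)

lemma sum_barycentric: "(\<Sum>j\<in>UNIV. barycentric z j) = 1"
  by (simp add: sum_UNIV_option barycentric_def)

lemma barycentric_cvec: "barycentric (cvec x) j = complex_of_real (barycentric x j)"
  by (cases j) (simp_all add: barycentric_def cvec_def)

lemma std_simplex_iff: "x \<in> std_simplex \<longleftrightarrow> (\<forall>j. 0 \<le> barycentric x j)"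
proof -
  have "(\<forall>j. 0 \<le> barycentric x j) \<longleftrightarrow> 0 \<le> barycentric x None \<and> (\<forall>i. 0 \<le> barycentric x (Some i))"
    by (metis option.exhaust)
  then show ?thesis
    by (auto simp: std_simplex_def barycentric_def)
qed

text \<open>The linear part of \<open>barycentric\<close>: the coordinates of a direction sum to 0
  instead of 1.\<close>

definition barycentric_dir :: "'a::comm_ring_1 ^ 'n::finite \<Rightarrow> 'n option \<Rightarrow> 'a" where
  "barycentric_dir y j = (case j of None \<Rightarrow> - (\<Sum>i\<in>UNIV. y $ i) | Some i \<Rightarrow> y $ i)"

lemma barycentric_add: "barycentric (x + y) j = barycentric x j + barycentric_dir y j"
  by (cases j) (simp_all add: barycentric_def barycentric_dir_def sum.distrib)

lemma barycentric_add_imaginary: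
  "barycentric (cvec x + (\<i> * complex_of_real \<epsilon>) *s cvec y) j =
    of_real (barycentric x j) + \<i> * of_real \<epsilon> * of_real (barycentric_dir y j)"
  unfolding barycentric_add barycentric_cvec
  by (cases j) (simp_all add: barycentric_dir_def cvec_def sum_distrib_left)

text \<open>A step of length \<open>e\<close> that stays in the simplex can lower coordinate
  \<open>j\<close> by exactly \<open>e\<close>; for \<open>None\<close> this is achieved by raising
  some other coordinate.\<close>

lemma barycentric_pos_of_interior:
  fixes x :: "real ^ 'n::finite"
  assumes "x \<in> interior std_simplex"
  shows "barycentric x j > 0"
proof -
  obtain e where e: "e > 0" "cball x e \<subseteq> std_simplex"
    using assms by (auto simp: mem_interior_cball)
  obtain k :: 'n where "case j of None \<Rightarrow> True | Some i \<Rightarrow> k = i"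
    by (cases j) auto
  define v :: "real ^ 'n" where "v = (if j = None then e else - e) *\<^sub>R axis k 1"
  have "norm v = e"
    using e(1) by (simp add: v_def norm_axis_1)
  then have "x + v \<in> std_simplex"
    using e(2) by (auto simp: dist_norm)
  then have "0 \<le> barycentric x j + barycentric_dir v j"
    by (simp add: std_simplex_iff barycentric_add)
  moreover have "barycentric_dir v j = - e"
    using \<open>case j of None \<Rightarrow> True | Some i \<Rightarrow> k = i\<close>
    by (cases j) (simp_all add: barycentric_dir_def v_def axis_def flip: sum_distrib_left)
  ultimately show ?thesis
    using e(1) by simp
qed

lemma convex_std_simplex: "convex (std_simplex :: (real ^ 'n::finite) set)"
proof (rule convexI)
  fix x y :: "real ^ 'n" and u v :: real
  assume "x \<in> std_simplex" "y \<in> std_simplex" and uv: "0 \<le> u" "0 \<le> v" "u + v = 1"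
  moreover have "barycentric (u *\<^sub>R x + v *\<^sub>R y) j = u * barycentric x j + v * barycentric y j" for j
  proof -
    have u: "u = 1 - v"
      using uv by simp
    show ?thesis
      unfolding u
      by (cases j) (simp_all add: barycentric_def sum.distrib sum_distrib_left algebra_simps sum_subtractf)
  qed
  ultimately show "u *\<^sub>R x + v *\<^sub>R y \<in> std_simplex"
    by (simp add: std_simplex_iff)
qed

subsection \<open>Symmetrized Chebyshev polynomials\<close>

text \<open>Odd powers of \<open>a\<close> cancel between \<open>a\<close> and \<open>- a\<close>.
  As the total exponent is even, \<open>b\<close> also keeps even exponents only, so the identity
  can be iterated sign by sign.\<close>

lemma binomial_even_part:
  fixes a b :: "'a::comm_ring_1"
  shows "(a + b) ^ (2 * k) + (- a + b) ^ (2 * k) =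
    (\<Sum>i\<le>k. 2 * of_nat ((2 * k) choose (2 * i)) * (a\<^sup>2) ^ i * b ^ (2 * (k - i)))"
proof -
  \<comment> \<open>The last odd index below \<open>2 * k\<close> is \<open>2 * k - 1\<close>, hence
    the range \<open>i < k\<close>.\<close>
  have *: "(\<Sum>i\<le>2 * k. f i) = (\<Sum>i\<le>k. f (2 * i)) + (\<Sum>i<k. f (2 * i + 1))" for f :: "nat \<Rightarrow> 'a"
    by (induction k) (simp_all add: algebra_simps)
  have "(- a) ^ (2 * i) = (a\<^sup>2) ^ i" "(- a) ^ (2 * i + 1) = - (a ^ (2 * i + 1))" "a ^ (2 * i) = (a\<^sup>2) ^ i" for i
    by (simp_all add: power_mult)
  moreover have "2 * k - 2 * i = 2 * (k - i)" for i
    by simp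
  ultimately show ?thesis
    unfolding binomial_ring *
    by (simp only: mult_minus_left mult_minus_right sum_negf)
      (simp add: sum_distrib_left mult_ac flip: mult_2)
qed

text \<open>Summing over all signs makes the expression even in each \<open>a j\<close>, so it
  depends only on the squares \<open>q j z\<close>. Each square counts as degree 1, which reduces
  the degree from \<open>2 * k\<close> to \<open>k\<close>. The induction is over all
  \<open>k\<close>, since removing an index produces the exponents \<open>k - i\<close>.\<close>

lemma even_power_signed_sums:
  fixes q :: "'j \<Rightarrow> 'a::field ^ 'n::finite \<Rightarrow> 'a"
  assumes "finite A" and "\<And>j. j \<in> A \<Longrightarrow> polynomial_upto 1 (q j)"
  shows "\<exists>P. polynomial_upto k P \<and> (\<forall>z a. (\<forall>j\<in>A. (a j)\<^sup>2 = q j z) \<longrightarrow>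
    (\<Sum>B\<in>Pow A. (\<Sum>j\<in>A. if j \<in> B then - a j else a j) ^ (2 * k)) = P z)"
  using assms
proof (induction A arbitrary: k rule: finite_induct)
  case empty
  show ?case
    by (intro exI[of _ "\<lambda>_. 0 ^ (2 * k)"]) (simp add: polynomial_upto_const)
next
  case (insert x A)
  have "\<forall>k. \<exists>P. polynomial_upto k P \<and> (\<forall>z a. (\<forall>j\<in>A. (a j)\<^sup>2 = q j z) \<longrightarrow>
    (\<Sum>B\<in>Pow A. (\<Sum>j\<in>A. if j \<in> B then - a j else a j) ^ (2 * k)) = P z)"
    using insert.IH insert.prems by blast
  then obtain P where P: "\<And>k. polynomial_upto k (P k)"
    "\<And>k z a. \<forall>j\<in>A. (a j)\<^sup>2 = q j z \<Longrightarrow>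
      (\<Sum>B\<in>Pow A. (\<Sum>j\<in>A. if j \<in> B then - a j else a j) ^ (2 * k)) = P k z"
    unfolding choice_iff by blast
  define Q where "Q z = (\<Sum>i\<le>k. of_nat (2 * ((2 * k) choose (2 * i))) * (q x z ^ i * P (k - i) z))" for z
  have "polynomial_upto k (\<lambda>z. q x z ^ i * P (k - i) z)" if "i \<le> k" for i
    using polynomial_upto_mult[OF polynomial_upto_power[OF insert.prems, of x i] P(1)[of "k - i"]] that
    by simp
  then have "polynomial_upto k Q"
    unfolding Q_def by (intro polynomial_upto_sum polynomial_upto_cmult) simp
  moreover have "(\<Sum>B\<in>Pow (insert x A). (\<Sum>j\<in>insert x A. if j \<in> B then - a j else a j) ^ (2 * k)) = Q z"
    if a: "\<forall>j\<in>insert x A. (a j)\<^sup>2 = q j z" for z a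
  proof -
    define L where "L B = (\<Sum>j\<in>A. if j \<in> B then - a j else a j)" for B
    \<comment> \<open>Subsets of \<open>insert x A\<close> come in pairs \<open>B\<close> and
      \<open>insert x B\<close> that differ only in the sign of \<open>a x\<close>.\<close>
    have L: "(\<Sum>j\<in>insert x A. if j \<in> B then - a j else a j) = a x + L B"
      "(\<Sum>j\<in>insert x A. if j \<in> insert x B then - a j else a j) = - a x + L B"
      if "B \<in> Pow A" for B
    proof -
      have "x \<notin> B"
        using that insert.hyps by auto
      moreover have "(\<Sum>j\<in>A. if j = x \<or> j \<in> B then - a j else a j) = L B"
        unfolding L_def using insert.hyps by (intro sum.cong) auto
      ultimately show "(\<Sum>j\<in>insert x A. if j \<in> B then - a j else a j) = a x + L B"
        "(\<Sum>j\<in>insert x A. if j \<in> insert x B then - a j else a j) = - a x + L B"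
        using insert.hyps by (simp_all add: L_def)
    qed
    have inj: "inj_on (insert x) (Pow A)"
      using insert.hyps by (auto simp: inj_on_def)
    have "Pow A \<inter> insert x ` Pow A = {}"
      using insert.hyps by auto
    then have "(\<Sum>B\<in>Pow (insert x A). (\<Sum>j\<in>insert x A. if j \<in> B then - a j else a j) ^ (2 * k)) =
      (\<Sum>B\<in>Pow A. (a x + L B) ^ (2 * k)) + (\<Sum>B\<in>Pow A. (- a x + L B) ^ (2 * k))"
      using insert.hyps
      by (simp only: Pow_insert sum.union_disjoint finite_Pow_iff finite_imageI sum.reindex[OF inj] o_def L
          cong: sum.cong)
    also have "\<dots> = (\<Sum>B\<in>Pow A. \<Sum>i\<le>k. of_nat (2 * ((2 * k) choose (2 * i))) * ((a x)\<^sup>2 ^ i * L B ^ (2 * (k - i))))"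
      by (simp only: sum.distrib[symmetric] binomial_even_part of_nat_mult of_nat_numeral mult.assoc)
    also have "\<dots> = (\<Sum>i\<le>k. of_nat (2 * ((2 * k) choose (2 * i))) * ((a x)\<^sup>2 ^ i * (\<Sum>B\<in>Pow A. L B ^ (2 * (k - i)))))"
      by (simp add: sum.swap[of _ "Pow A"] sum_distrib_left)
    also have "\<dots> = Q z"
      using a P(2)[of a z] by (simp add: Q_def L_def)
    finally show ?thesis .
  qed
  ultimately show ?case
    by blast
qed

section \<open>Chebyshev polynomials and the Joukowsky map\<close>

fun chebyshev :: "nat \<Rightarrow> 'a::comm_ring_1 poly" where
  "chebyshev 0 = 1"
| "chebyshev (Suc 0) = [:0, 1:]"
| "chebyshev (Suc (Suc n)) = [:0, 2:] * chebyshev (Suc n) - chebyshev n"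

lemma degree_chebyshev_le: "degree (chebyshev n :: 'a::comm_ring_1 poly) \<le> n"
proof (induction n rule: chebyshev.induct)
  case (3 n)
  have "degree ([:0, 2:] * chebyshev (Suc n) :: 'a poly) \<le> 1 + Suc n"
    by (rule order_trans[OF degree_mult_le add_mono]) (use 3 in auto)
  then show ?case
    unfolding chebyshev.simps using 3 by (intro degree_diff_le) auto
qed auto

text \<open>Since \<open>v\<close> and \<open>1 / v\<close> have product 1, the right-hand side
  satisfies the Chebyshev recurrence.\<close>

lemma poly_chebyshev_joukowsky:
  fixes v :: "'a::field_char_0"
  assumes "v \<noteq> 0"
  shows "poly (chebyshev n) ((v + 1 / v) / 2) = (v ^ n + 1 / v ^ n) / 2"
proof (induction n rule: chebyshev.induct)
  case (3 n)
  define w where "w = 1 / v"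
  have vw: "v * w = 1" "1 / v ^ k = w ^ k" for k
    using assms by (simp_all add: w_def power_divide)
  have *: "(v + w) * (v ^ Suc n + w ^ Suc n) = v ^ Suc (Suc n) + w ^ Suc (Suc n) + (v * w) * (v ^ n + w ^ n)"
    by (simp add: algebra_simps)
  have "poly (chebyshev (Suc (Suc n))) ((v + w) / 2) =
    (v + w) * ((v ^ Suc n + w ^ Suc n) / 2) - (v ^ n + w ^ n) / 2"
    using 3 by (simp only: chebyshev.simps poly_diff poly_mult vw(2) w_def[symmetric])
      (simp del: power_Suc)
  also have "\<dots> = (v ^ Suc (Suc n) + w ^ Suc (Suc n)) / 2"
    unfolding times_divide_eq_right * vw(1) by (simp add: diff_divide_distrib[symmetric])
  finally show ?case
    by (simp only: vw(2) w_def[symmetric])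
qed auto

text \<open>The two solutions of \<open>v^2 - 2 * s * v + 1 = 0\<close> have product 1, so one of
  them has modulus at least 1.\<close>

lemma joukowsky_surj:
  fixes s :: complex
  obtains v where "v \<noteq> 0" and "cmod v \<ge> 1" and "(v + 1 / v) / 2 = s"
proof -
  define v where "v = s + csqrt (s\<^sup>2 - 1)"
  have "v * (s - csqrt (s\<^sup>2 - 1)) = 1"
    unfolding v_def by (simp add: algebra_simps power2_eq_square[symmetric])
  then have "v \<noteq> 0" and "1 / v = s - csqrt (s\<^sup>2 - 1)"
    by (auto simp: divide_eq_eq mult.commute)
  then have v: "v \<noteq> 0" "(v + 1 / v) / 2 = s"
    by (simp_all add: v_def)
  show thesis
  proof (cases "cmod v \<ge> 1")
    case True
    then show thesis
      using v that by blast
  next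
    case False
    then have "cmod (1 / v) \<ge> 1"
      using v by (simp add: norm_divide)
    then show thesis
      using v that[of "1 / v"] by (simp add: add.commute)
  qed
qed

text \<open>With \<open>t\<close> written as a cosine, its Joukowsky preimage lies on the unit
  circle, where both powers have modulus 1.\<close>

lemma norm_poly_chebyshev_le_1:
  assumes "\<bar>t\<bar> \<le> 1"
  shows "cmod (poly (chebyshev n) (complex_of_real t)) \<le> 1"
proof -
  define v where "v = cis (arccos t)"
  have "v \<noteq> 0" and [simp]: "cmod v = 1"
    by (auto simp: v_def)
  moreover have "1 / v = cis (- arccos t)"
    by (simp add: v_def divide_inverse)
  then have "(v + 1 / v) / 2 = complex_of_real t"
    using assms by (simp add: v_def complex_eq_iff cos_arccos_abs)
  ultimately have "cmod (poly (chebyshev n) (complex_of_real t)) = cmod ((v ^ n + 1 / v ^ n) / 2)"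
    using poly_chebyshev_joukowsky by metis
  also have "\<dots> \<le> (cmod (v ^ n) + cmod (1 / v ^ n)) / 2"
    using norm_triangle_ineq[of "v ^ n" "1 / v ^ n"] by (simp add: norm_divide)
  also have "\<dots> = 1"
    by (simp add: norm_divide norm_power)
  finally show ?thesis .
qed

text \<open>Here \<open>2 L\<^sup>2 - 1\<close> occurs because the Chebyshev polynomials satisfy \<open>T\<^sub>2\<^sub>n(L) = T\<^sub>n(2 L\<^sup>2 - 1)\<close>.\<close>

lemma symmetrized_chebyshev:
  fixes u :: "'n::finite option \<Rightarrow> 'a::field"
  shows "\<exists>P. polynomial_upto n P \<and> (\<forall>z w. (\<forall>j. (w j)\<^sup>2 = barycentric z j) \<longrightarrow>
    (\<Sum>B\<in>UNIV. poly (chebyshev n) (2 * (\<Sum>j\<in>UNIV. if j \<in> B then - (u j * w j) else u j * w j)\<^sup>2 - 1)) = P z)"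
proof -
  \<comment> \<open>As a polynomial in \<open>L^2\<close> the summand is \<open>Q\<close> of degree
    at most \<open>n\<close>, so only the even powers \<open>L ^ (2 * k)\<close> with
    \<open>k \<le> n\<close> have to be symmetrized.\<close>
  define Q :: "'a poly" where "Q = pcompose (chebyshev n) [:- 1, 2:]"
  have "degree Q \<le> degree (chebyshev n :: 'a poly) * degree [:- 1, 2 :: 'a:]"
    unfolding Q_def by (rule degree_pcompose_le)
  also have "\<dots> \<le> n * 1"
    by (intro mult_le_mono degree_chebyshev_le) simp
  finally have deg: "degree Q \<le> n"
    by simp
  have Q: "poly (chebyshev n) (2 * x - 1) = (\<Sum>k\<le>n. coeff Q k * x ^ k)" for x
  proof -
    have "poly (chebyshev n) (2 * x - 1) = poly Q x"
      by (simp add: Q_def poly_pcompose algebra_simps)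
    also have "\<dots> = (\<Sum>k\<le>degree Q. coeff Q k * x ^ k)"
      by (rule poly_altdef)
    also have "\<dots> = (\<Sum>k\<le>n. coeff Q k * x ^ k)"
      using deg by (intro sum.mono_neutral_left) (auto simp: coeff_eq_0)
    finally show ?thesis .
  qed
  \<comment> \<open>This is used with \<open>a j = u j * w j\<close>, whose square is affine in
    \<open>z\<close>.\<close>
  have "\<forall>k. \<exists>P. polynomial_upto k P \<and> (\<forall>z a. (\<forall>j\<in>UNIV. (a j)\<^sup>2 = (u j)\<^sup>2 * barycentric z j) \<longrightarrow>
    (\<Sum>B\<in>Pow UNIV. (\<Sum>j\<in>UNIV. if j \<in> B then - a j else a j) ^ (2 * k)) = P z)"
    by (intro allI even_power_signed_sums polynomial_upto_cmult polynomial_upto_barycentric) simp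
  then obtain P where P: "\<And>k. polynomial_upto k (P k)"
    "\<And>k z a. \<forall>j\<in>UNIV. (a j)\<^sup>2 = (u j)\<^sup>2 * barycentric z j \<Longrightarrow>
      (\<Sum>B\<in>UNIV. (\<Sum>j\<in>UNIV. if j \<in> B then - a j else a j) ^ (2 * k)) = P k z"
    unfolding choice_iff Pow_UNIV by blast
  show ?thesis
  proof (intro exI conjI allI impI)
    show "polynomial_upto n (\<lambda>z. \<Sum>k\<le>n. coeff Q k * P k z)"
      using P(1) polynomial_upto_mono by (intro polynomial_upto_sum polynomial_upto_cmult) blast
    fix z and w :: "'n option \<Rightarrow> 'a"
    assume w: "\<forall>j. (w j)\<^sup>2 = barycentric z j"
    define L where "L B = (\<Sum>j\<in>UNIV. if j \<in> B then - (u j * w j) else u j * w j)" for B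
    have "(\<Sum>B\<in>UNIV. L B ^ (2 * k)) = P k z" for k
      unfolding L_def by (rule P(2)) (simp add: w power_mult_distrib)
    then have "(\<Sum>k\<le>n. coeff Q k * P k z) = (\<Sum>B\<in>UNIV. \<Sum>k\<le>n. coeff Q k * ((L B)\<^sup>2) ^ k)"
      unfolding sum.swap[of _ "{..n}" UNIV] sum_distrib_left[symmetric] by (simp add: power_mult)
    then show "(\<Sum>B\<in>UNIV. poly (chebyshev n) (2 * (L B)\<^sup>2 - 1)) = (\<Sum>k\<le>n. coeff Q k * P k z)"
      by (simp only: Q)
  qed
qed

text \<open>On the simplex the square roots of the coordinates form a real unit vector. By
  Cauchy-Schwarz every signed sum lies in [-1, 1], and so does the argument of the Chebyshev
  polynomial.\<close>

lemma norm_symmetrized_chebyshev_le: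
  fixes x :: "real ^ 'n::finite" and u :: "'n option \<Rightarrow> real"
  assumes "x \<in> std_simplex" and "(\<Sum>j\<in>UNIV. (u j)\<^sup>2) = 1"
  shows "cmod (poly (chebyshev n) (2 * (\<Sum>j\<in>UNIV. if j \<in> B
    then - (complex_of_real (u j) * of_real (sqrt (barycentric x j)))
    else of_real (u j) * of_real (sqrt (barycentric x j)))\<^sup>2 - 1)) \<le> 1"
proof -
  define r where "r = (\<Sum>j\<in>UNIV. (if j \<in> B then - u j else u j) * sqrt (barycentric x j))"
  have "r\<^sup>2 \<le> (\<Sum>j\<in>UNIV. (if j \<in> B then - u j else u j)\<^sup>2) * (\<Sum>j\<in>UNIV. (sqrt (barycentric x j))\<^sup>2)"
    unfolding r_def by (rule Cauchy_Schwarz_ineq_sum)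
  also have "(\<Sum>j\<in>UNIV. (if j \<in> B then - u j else u j)\<^sup>2) = (\<Sum>j\<in>UNIV. (u j)\<^sup>2)"
    by (rule sum.cong) simp_all
  also have "(\<Sum>j\<in>UNIV. (sqrt (barycentric x j))\<^sup>2) = 1"
    using assms(1) by (simp add: std_simplex_iff sum_barycentric)
  finally have "\<bar>2 * r\<^sup>2 - 1\<bar> \<le> 1"
    using assms(2) by (auto simp: abs_le_iff)
  moreover have "(\<Sum>j\<in>UNIV. if j \<in> B
    then - (complex_of_real (u j) * of_real (sqrt (barycentric x j)))
    else of_real (u j) * of_real (sqrt (barycentric x j))) = of_real r"
    unfolding r_def of_real_sum by (rule sum.cong) simp_all
  ultimately show ?thesis
    using norm_poly_chebyshev_le_1[of "2 * r\<^sup>2 - 1"] by simp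
qed

subsection \<open>Lower bound for the extremal function of the simplex\<close>

text \<open>Dirichlet's theorem brings all angles \<open>n * \<theta> i\<close> at once within a
  sixth of a turn of a full turn, that is, within \<open>pi / 3\<close>.\<close>

lemma simultaneous_cos_ge_half:
  fixes \<theta> :: "'i \<Rightarrow> real"
  assumes "finite I"
  obtains n where "n \<ge> N" and "n \<ge> 1" and "\<And>i. i \<in> I \<Longrightarrow> cos (real n * \<theta> i) \<ge> 1 / 2"
proof -
  obtain h where h: "bij_betw h {..<card I} I"
    using ex_bij_betw_nat_finite[OF assms] unfolding atLeast0LessThan by blast
  \<comment> \<open>The factor \<open>Suc N\<close> makes \<open>n\<close> a multiple of
    \<open>Suc N\<close>, which forces \<open>n \<ge> N\<close>.\<close>
  define \<phi> where "\<phi> i = real (Suc N) * \<theta> (h i) / (2 * pi)" for i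
  obtain q p where q: "0 < q" and p: "\<And>i. i < card I \<Longrightarrow> \<bar>of_int q * \<phi> i - of_int (p i)\<bar> < 1 / real 6"
    by (rule Dirichlet_approx_simult[of 6 "card I" \<phi>]) (simp, rule that)
  define n where "n = nat q * Suc N"
  have "n \<ge> Suc N"
    using mult_le_mono1[of 1 "nat q" "Suc N"] q by (simp add: n_def)
  moreover have "cos (real n * \<theta> i) \<ge> 1 / 2" if "i \<in> I" for i
  proof -
    from that have "i \<in> h ` {..<card I}"
      unfolding bij_betw_imp_surj_on[OF h] .
    then obtain k where k: "k < card I" "h k = i"
      by (elim imageE) simp
    define r where "r = of_int q * \<phi> k - of_int (p k)"
    have "2 * pi * \<phi> k = real (Suc N) * \<theta> i"
      using k by (simp add: \<phi>_def)
    then have "real n * \<theta> i = of_int q * (2 * pi * \<phi> k)"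
      using q by (simp add: n_def distrib_left)
    also have "\<dots> = 2 * pi * r + 2 * pi * of_int (p k)"
      by (simp add: r_def algebra_simps)
    finally have "real n * \<theta> i = 2 * pi * r + 2 * pi * of_int (p k)" .
    then have "cos (real n * \<theta> i) = cos (2 * pi * r)"
      by (simp only: cos_add cos_int_2pin sin_int_2pin mult_1_right mult_zero_right diff_0_right)
    also have "\<dots> = cos (2 * pi * \<bar>r\<bar>)"
      by (cases "r \<ge> 0") simp_all
    also have "\<dots> \<ge> cos (pi / 3)"
    proof (rule cos_monotone_0_pi_le)
      have "\<bar>r\<bar> \<le> 1 / 6"
        using p[OF k(1)] by (simp add: r_def)
      then show "2 * pi * \<bar>r\<bar> \<le> pi / 3"
        using mult_left_mono[of "\<bar>r\<bar>" "1 / 6" "2 * pi"] by simp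
    qed simp_all
    finally show ?thesis
      by (simp only: cos_60)
  qed
  ultimately show thesis
    using that[of n] by simp
qed

text \<open>The averaged Chebyshev polynomial is a competitor of degree \<open>n\<close> whose
  modulus at \<open>z\<close> is at least a constant times \<open>cmod v ^ (2 * n)\<close>; this is
  the source of the factor 2. The constant disappears after taking the logarithm and dividing by a
  large \<open>n\<close>.\<close>

lemma siciak_std_simplex_ge:
  fixes z :: "complex ^ 'n::finite" and u :: "'n option \<Rightarrow> real"
  assumes z: "z \<notin> cvec ` std_simplex" and u: "(\<Sum>j\<in>UNIV. (u j)\<^sup>2) = 1"
    and w: "\<And>j. (w j)\<^sup>2 = barycentric z j"
    and v: "cmod v \<ge> 1" "(v + 1 / v) / 2 = (\<Sum>j\<in>UNIV. of_real (u j) * w j)"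
  shows "siciak (cvec ` std_simplex) z \<ge> ereal (2 * ln (cmod v))"
proof (rule ereal_le_epsilon2)
  fix e :: real assume e: "e > 0"
  define C where "C = real (card (UNIV :: 'n option set set))"
  have C: "C > 0"
    by (simp add: C_def finite_UNIV_card_ge_0)
  define L where "L B = (\<Sum>j\<in>UNIV. if j \<in> B then - (of_real (u j) * w j) else of_real (u j) * w j)" for B
  \<comment> \<open>\<open>B\<close> is the set of flipped signs; for \<open>B = {}\<close> the
    preimage must be the given \<open>v\<close>.\<close>
  have "\<forall>B. \<exists>V. cmod V \<ge> 1 \<and> (V + 1 / V) / 2 = L B \<and> (B = {} \<longrightarrow> V = v)"
  proof
    fix B
    show "\<exists>V. cmod V \<ge> 1 \<and> (V + 1 / V) / 2 = L B \<and> (B = {} \<longrightarrow> V = v)"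
    proof (cases "B = {}")
      case True
      then show ?thesis
        using v by (auto simp: L_def)
    next
      case False
      then show ?thesis
        using joukowsky_surj[of "L B"] by metis
    qed
  qed
  then obtain V where V: "\<And>B. cmod (V B) \<ge> 1" "\<And>B. (V B + 1 / V B) / 2 = L B" "V {} = v"
    unfolding choice_iff by blast
  have V0: "V B \<noteq> 0" for B
    using V(1)[of B] by auto
  \<comment> \<open>For \<open>n \<ge> N\<close> the loss \<open>ln (4 * C) / n\<close> caused by
    normalization is at most \<open>e\<close>.\<close>
  obtain N :: nat where N: "real N \<ge> ln (4 * C) / e"
    using real_arch_simple by blast
  obtain n where n: "n \<ge> N" "n \<ge> 1" and
    cos: "\<And>B. cos (real n * (2 * Arg (V B))) \<ge> 1 / 2"
    using simultaneous_cos_ge_half[of "UNIV :: 'n option set set" N "\<lambda>B. 2 * Arg (V B)"] by auto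
  obtain P where P: "polynomial_upto n P" "\<And>z w. (\<forall>j. (w j)\<^sup>2 = barycentric z j) \<Longrightarrow>
      (\<Sum>B\<in>UNIV. poly (chebyshev n) (2 * (\<Sum>j\<in>UNIV. if j \<in> B
        then - (complex_of_real (u j) * w j) else of_real (u j) * w j)\<^sup>2 - 1)) = P z"
    using symmetrized_chebyshev[of n "\<lambda>j. complex_of_real (u j)"] by blast
  have term_eq: "poly (chebyshev n) (2 * (L B)\<^sup>2 - 1) = (V B ^ (2 * n) + 1 / V B ^ (2 * n)) / 2" for B
  proof -
    have "2 * (L B)\<^sup>2 - 1 = ((V B)\<^sup>2 + 1 / (V B)\<^sup>2) / 2"
      using V0[of B] by (simp add: V(2)[symmetric] power2_eq_square field_simps)
    then show ?thesis
      using poly_chebyshev_joukowsky[of "(V B)\<^sup>2" n] V0[of B] by (simp only: power_mult) simp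
  qed
  have pow: "V B ^ (2 * n) = rcis (cmod (V B) ^ (2 * n)) (real n * (2 * Arg (V B)))" for B
    by (metis DeMoivre2 rcis_cmod_Arg of_nat_mult of_nat_numeral mult.assoc mult.commute)
  \<comment> \<open>By the choice of \<open>n\<close>, all terms have nonnegative real part.\<close>
  have Re_term: "Re (poly (chebyshev n) (2 * (L B)\<^sup>2 - 1)) \<ge> cmod (V B) ^ (2 * n) / 4" for B
  proof -
    have "cmod (V B) ^ (2 * n) * (1 / 2) \<le> cmod (V B) ^ (2 * n) * cos (real n * (2 * Arg (V B)))"
      by (intro mult_left_mono cos) simp
    also have "\<dots> = Re (V B ^ (2 * n))"
      unfolding pow by simp
    finally have "cmod (V B) ^ (2 * n) / 2 \<le> Re (V B ^ (2 * n))"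
      by simp
    \<comment> \<open>The reciprocal has the opposite argument, hence the same cosine. The 4
      combines the cosine bound 1/2 with the factor 1/2 in \<open>term_eq\<close>.\<close>
    moreover have "0 \<le> Re (1 / V B ^ (2 * n))"
      using cos[of B] unfolding pow divide_inverse rcis_inverse by simp
    ultimately show ?thesis
      unfolding term_eq by simp
  qed
  have "cmod v ^ (2 * n) / 4 \<le> Re (poly (chebyshev n) (2 * (L {})\<^sup>2 - 1))"
    using Re_term[of "{}"] V(3) by simp
  also have "\<dots> \<le> (\<Sum>B\<in>UNIV. Re (poly (chebyshev n) (2 * (L B)\<^sup>2 - 1)))"
    by (intro member_le_sum order_trans[OF _ Re_term]) auto
  also have "\<dots> = Re (P z)"
    using P(2)[of w z] w by (simp add: L_def flip: Re_sum)
  also have "\<dots> \<le> cmod (P z)"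
    by (rule complex_Re_le_cmod)
  finally have Pz: "cmod v ^ (2 * n) / 4 \<le> cmod (P z)" .
  define p where "p = (\<lambda>z. of_real (1 / C) * P z)"
  have "cmod v ^ (2 * n) > 0"
    using v(1) by (intro zero_less_power) linarith
  moreover have "cmod v ^ (2 * n) / (4 * C) \<le> cmod (p z)"
    using Pz C by (simp add: p_def norm_mult norm_divide field_simps)
  ultimately have pz: "0 < cmod v ^ (2 * n) / (4 * C)" "cmod v ^ (2 * n) / (4 * C) \<le> cmod (p z)"
    using C by simp_all
  note pz_pos = less_le_trans[OF pz]
  then have "p z \<noteq> 0"
    by simp
  have ln: "ln (cmod v ^ (2 * n) / (4 * C)) \<le> ln (cmod (p z))"
    using pz(2) unfolding ln_le_cancel_iff[OF pz(1) pz_pos] .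
  have "ln (cmod v ^ (2 * n) / (4 * C)) = 2 * real n * ln (cmod v) - ln (4 * C)"
    using v(1) C by (subst ln_div) (auto simp: ln_realpow)
  moreover have "ln (4 * C) \<le> real n * e"
    using N n(1) e by (simp add: divide_le_eq) (metis mult_right_mono of_nat_le_iff order_trans less_imp_le)
  ultimately have "real n * (2 * ln (cmod v) - e) \<le> ln (cmod (p z))"
    using ln by (simp add: algebra_simps)
  then have "2 * ln (cmod v) \<le> ln (cmod (p z)) / real n + e"
    using n(2) by (simp add: field_simps)
  then have "ereal (2 * ln (cmod v)) \<le> log_abs (p z) / ereal (real n) + ereal e"
    using \<open>p z \<noteq> 0\<close> n(2) by (simp add: log_abs_def)
  also have "log_abs (p z) / ereal (real n) \<le> siciak (cvec ` std_simplex) z"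
  proof -
    have "polynomial_upto n p"
      unfolding p_def by (intro polynomial_upto_cmult P(1))
    moreover have "p \<noteq> (\<lambda>_. 0)"
      using \<open>p z \<noteq> 0\<close> by auto
    moreover have "sup_norm (cvec ` std_simplex) p \<le> 1"
      unfolding sup_norm_def
    proof (rule SUP_least)
      fix z' :: "complex ^ 'n" assume "z' \<in> cvec ` std_simplex"
      then obtain x where x: "x \<in> std_simplex" and z': "z' = cvec x"
        by auto
      define w' where "w' j = complex_of_real (sqrt (barycentric x j))" for j
      have "\<forall>j. (w' j)\<^sup>2 = barycentric z' j"
        using x by (simp add: w'_def z' barycentric_cvec std_simplex_iff flip: of_real_power)
      then have "cmod (P z') = cmod (\<Sum>B\<in>UNIV. poly (chebyshev n) (2 * (\<Sum>j\<in>UNIV. if j \<in> B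
          then - (complex_of_real (u j) * w' j) else of_real (u j) * w' j)\<^sup>2 - 1))"
        using P(2)[of w' z'] by simp
      also have "\<dots> \<le> (\<Sum>B\<in>(UNIV :: 'n option set set). 1)"
        unfolding w'_def by (intro order_trans[OF norm_sum] sum_mono norm_symmetrized_chebyshev_le x u)
      finally have "cmod (P z') \<le> C"
        by (simp add: C_def)
      then show "ereal (cmod (p z')) \<le> 1"
        using C by (simp add: p_def norm_mult norm_divide)
    qed
    ultimately show ?thesis
      using z n(2) unfolding siciak_def by (auto intro!: Sup_upper)
  qed
  finally show "ereal (2 * ln (cmod v)) \<le> siciak (cvec ` std_simplex) z + ereal e"
    by (simp add: add_right_mono)
qed

text \<open>The circle of radius \<open>r\<close> is mapped to an ellipse with imaginary half axis
  \<open>(r - 1 / r) / 2 = sinh (ln r)\<close>. Hence only the imaginary part of the signed sum is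
  needed to bound \<open>cmod v\<close> from below.\<close>

lemma arsinh_Im_joukowsky_le:
  assumes "cmod v \<ge> 1"
  shows "arsinh (Im ((v + 1 / v) / 2)) \<le> ln (cmod v)"
proof -
  define r where "r = cmod v"
  have r: "r \<ge> 1"
    using assms by (simp add: r_def)
  have "Im (1 / v) = - (Im v / r\<^sup>2)"
    by (simp add: Im_divide r_def cmod_def)
  then have "Im ((v + 1 / v) / 2) = Im v * ((1 - 1 / r\<^sup>2) / 2)"
    by (simp add: algebra_simps diff_divide_distrib)
  also have "\<dots> \<le> r * ((1 - 1 / r\<^sup>2) / 2)"
    using r abs_Im_le_cmod[of v] by (intro mult_right_mono) (auto simp: r_def divide_le_eq_1)
  also have "\<dots> = sinh (ln r)"
    using r by (simp add: sinh_ln_real field_simps power2_eq_square)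
  finally show ?thesis
    unfolding r_def using sinh_real_le_iff[of "arsinh (Im ((v + 1 / v) / 2))" "ln (cmod v)"]
    by (simp only: sinh_arsinh_real)
qed

text \<open>\<open>b > 0\<close> keeps the point off the branch cut, so the complex derivative can
  be restricted to real \<open>\<epsilon>\<close>.\<close>

lemma Im_csqrt_derivative:
  assumes "b > 0"
  shows "((\<lambda>\<epsilon>. Im (csqrt (of_real b + \<i> * of_real \<epsilon> * of_real d))) has_real_derivative d / (2 * sqrt b)) (at 0)"
proof -
  have "((\<lambda>\<zeta>. csqrt (of_real b + \<i> * \<zeta> * of_real d)) has_field_derivative
      \<i> * of_real d * (1 / (2 * of_real (sqrt b)))) (at (of_real 0))"
    using assms by (auto intro!: derivative_eq_intros simp: complex_nonpos_Reals_iff field_simps)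
  from has_vector_derivative_real_field[OF this]
  have "((\<lambda>\<epsilon>. csqrt (of_real b + \<i> * of_real \<epsilon> * of_real d)) has_vector_derivative
      \<i> * of_real d * (1 / (2 * of_real (sqrt b)))) (at 0)"
    by simp
  from bounded_linear.has_vector_derivative[OF bounded_linear_Im this]
  have "((\<lambda>\<epsilon>. Im (csqrt (of_real b + \<i> * of_real \<epsilon> * of_real d))) has_real_derivative
      Im (\<i> * of_real d * (1 / (2 * of_real (sqrt b))))) (at 0)"
    by (simp only: has_real_derivative_iff_has_vector_derivative)
  also have "\<i> * of_real d * (1 / (2 * of_real (sqrt b))) = \<i> * of_real (d / (2 * sqrt b))"
    by simp
  finally show ?thesis
    by simp
qed

lemma siciak_deriv_std_simplex_ge:
  fixes x y :: "real ^ 'n::finite"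
  assumes x: "\<And>j. barycentric x j > 0" and "y \<noteq> 0"
  defines "S \<equiv> \<Sum>j\<in>UNIV. (barycentric_dir y j)\<^sup>2 / barycentric x j"
  shows "S > 0" and "ereal (sqrt S) \<le> siciak_deriv std_simplex y x"
proof -
  obtain k where k: "y $ k \<noteq> 0"
    using \<open>y \<noteq> 0\<close> by (auto simp: vec_eq_iff)
  show "S > 0"
    unfolding S_def
  proof (rule sum_pos2[of _ "Some k"])
    show "0 < (barycentric_dir y (Some k))\<^sup>2 / barycentric x (Some k)"
      using k x[of "Some k"] by (simp add: barycentric_dir_def)
  qed (use x in \<open>auto intro!: divide_nonneg_pos\<close>)
  \<comment> \<open>The unit vector that maximizes the slope of \<open>g\<close> at 0, by the
    equality case of Cauchy-Schwarz.\<close>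
  define u where "u j = barycentric_dir y j / sqrt (barycentric x j * S)" for j
  have u: "(\<Sum>j\<in>UNIV. (u j)\<^sup>2) = 1"
  proof -
    have "(u j)\<^sup>2 = (barycentric_dir y j)\<^sup>2 / barycentric x j / S" for j
      using x[of j] \<open>S > 0\<close> by (simp add: u_def power_divide)
    then have "(\<Sum>j\<in>UNIV. (u j)\<^sup>2) = S / S"
      by (simp only: S_def sum_divide_distrib[symmetric])
    then show ?thesis
      using \<open>S > 0\<close> by simp
  qed
  define w where "w \<epsilon> j = csqrt (of_real (barycentric x j) + \<i> * of_real \<epsilon> * of_real (barycentric_dir y j))" for \<epsilon> j
  define g where "g \<epsilon> = (\<Sum>j\<in>UNIV. u j * Im (w \<epsilon> j))" for \<epsilon>
  define h where "h \<epsilon> = 2 * arsinh (g \<epsilon>)" for \<epsilon>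
  have g0: "g 0 = 0"
    using x by (simp add: g_def w_def less_imp_le)
  have "(g has_real_derivative (\<Sum>j\<in>UNIV. u j * (barycentric_dir y j / (2 * sqrt (barycentric x j))))) (at 0)"
    unfolding g_def w_def by (intro DERIV_sum DERIV_cmult Im_csqrt_derivative x)
  also have "(\<Sum>j\<in>UNIV. u j * (barycentric_dir y j / (2 * sqrt (barycentric x j)))) = sqrt S / 2"
  proof -
    have "u j * (barycentric_dir y j / (2 * sqrt (barycentric x j))) =
        (barycentric_dir y j)\<^sup>2 / barycentric x j / (2 * sqrt S)" for j
      using x[of j] by (simp add: u_def real_sqrt_mult power2_eq_square field_simps)
    then have "(\<Sum>j\<in>UNIV. u j * (barycentric_dir y j / (2 * sqrt (barycentric x j)))) = S / (2 * sqrt S)"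
      by (simp only: S_def sum_divide_distrib[symmetric])
    also have "\<dots> = sqrt S / 2"
      using \<open>S > 0\<close> by (simp add: field_simps)
    finally show ?thesis .
  qed
  finally have "(g has_real_derivative sqrt S / 2) (at 0)" .
  then have "(h has_real_derivative 2 * (1 / sqrt ((g 0)\<^sup>2 + 1) * (sqrt S / 2))) (at 0)"
    unfolding h_def by (intro DERIV_cmult DERIV_chain2[OF arsinh_real_has_field_derivative])
  then have "(h has_real_derivative sqrt S) (at 0)"
    by (simp add: g0)
  then have "((\<lambda>\<epsilon>. h \<epsilon> / \<epsilon>) \<longlongrightarrow> sqrt S) (at 0)"
    by (simp add: DERIV_def h_def g0)
  then have "((\<lambda>\<epsilon>. ereal (h \<epsilon> / \<epsilon>)) \<longlongrightarrow> ereal (sqrt S)) (at_right 0)"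
    by (intro tendsto_ereal) (rule tendsto_mono[OF at_le], auto)
  then have "ereal (sqrt S) = Liminf (at_right 0) (\<lambda>\<epsilon>. ereal (h \<epsilon> / \<epsilon>))"
    by (intro lim_imp_Liminf[symmetric]) auto
  also have "\<dots> \<le> siciak_deriv std_simplex y x"
    unfolding siciak_deriv_def
  proof (rule Liminf_mono)
    show "\<forall>\<^sub>F \<epsilon> in at_right 0. ereal (h \<epsilon> / \<epsilon>) \<le>
        siciak (cvec ` std_simplex) (cvec x + (\<i> * complex_of_real \<epsilon>) *s cvec y) / ereal \<epsilon>"
      using eventually_at_right_less[of 0]
    proof eventually_elim
      case (elim \<epsilon>)
      let ?z = "cvec x + (\<i> * complex_of_real \<epsilon>) *s cvec y"
      \<comment> \<open>Coordinate \<open>k\<close> is not real, so the value of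
        \<open>siciak\<close> at \<open>?z\<close> is the supremum and not the default 0.\<close>
      have "?z \<noteq> cvec x'" for x'
      proof
        assume "?z = cvec x'"
        then have "Im (?z $ k) = Im (cvec x' $ k)"
          by simp
        then show False
          using k elim by (simp add: cvec_def)
      qed
      then have "?z \<notin> cvec ` std_simplex"
        by auto
      moreover have "(w \<epsilon> j)\<^sup>2 = barycentric ?z j" for j
        by (simp add: w_def barycentric_add_imaginary)
      moreover obtain v where v: "cmod v \<ge> 1" "(v + 1 / v) / 2 = (\<Sum>j\<in>UNIV. of_real (u j) * w \<epsilon> j)"
        using joukowsky_surj by metis
      ultimately have "ereal (2 * ln (cmod v)) \<le> siciak (cvec ` std_simplex) ?z"
        using u by (intro siciak_std_simplex_ge) auto
      moreover have "h \<epsilon> \<le> 2 * ln (cmod v)"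
        using arsinh_Im_joukowsky_le[OF v(1)] unfolding v(2) h_def g_def by simp
      ultimately have "ereal (h \<epsilon>) \<le> siciak (cvec ` std_simplex) ?z"
        by (meson ereal_less_eq(3) order_trans)
      then have "ereal (h \<epsilon>) / ereal \<epsilon> \<le> siciak (cvec ` std_simplex) ?z / ereal \<epsilon>"
        using elim by (intro ereal_divide_right_mono) auto
      then show ?case
        using elim by simp
    qed
  qed
  finally show "ereal (sqrt S) \<le> siciak_deriv std_simplex y x" .
qed

subsection \<open>Upper bound by inscribed ellipses\<close>

text \<open>The rational map \<open>f\<close> sends the unit circle into \<open>K\<close> and
  \<open>exp (- s)\<close> to the given point. By the maximum principle in the unit disc,
  \<open>exp (- s) ^ n * cmod (p ?z) \<le> 1\<close>.\<close>

lemma siciak_le_on_ellipse: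
  fixes K :: "(real ^ 'n::finite) set"
  assumes ellipse: "\<And>t. c + cos t *\<^sub>R a + sin t *\<^sub>R b \<in> K" and "s \<ge> 0"
  shows "siciak (cvec ` K) (cvec c + of_real (cosh s) *s cvec a + (\<i> * of_real (sinh s)) *s cvec b) \<le> ereal s"
    (is "siciak _ ?z \<le> _")
proof (cases "?z \<in> cvec ` K")
  case True
  then show ?thesis
    using assms(2) by (simp add: siciak_def)
next
  case False
  define f where "f \<zeta> = (\<chi> i. of_real (c $ i) + of_real (a $ i) * ((\<zeta> + 1 / \<zeta>) / 2)
    + of_real (b $ i) * ((\<zeta> - 1 / \<zeta>) / (2 * \<i>)))" for \<zeta> :: complex
  \<comment> \<open>\<open>q\<close> clears the simple pole of \<open>f\<close> at 0.\<close>
  define q where "q i \<zeta> = of_real (c $ i) * \<zeta> + of_real (a $ i) * ((\<zeta>\<^sup>2 + 1) / 2)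
    + of_real (b $ i) * ((\<zeta>\<^sup>2 - 1) / (2 * \<i>))" for i and \<zeta> :: complex
  have qf: "q i \<zeta> = \<zeta> * f \<zeta> $ i" if "\<zeta> \<noteq> 0" for i \<zeta>
    using that by (simp add: q_def f_def field_simps power2_eq_square)
  have f_cis: "f (cis t) = cvec (c + cos t *\<^sub>R a + sin t *\<^sub>R b)" for t
  proof -
    have inv: "1 / cis t = cis (- t)"
      by (simp add: divide_inverse)
    have "(cis t + 1 / cis t) / 2 = of_real (cos t)" "(cis t - 1 / cis t) / (2 * \<i>) = of_real (sin t)"
      unfolding inv by (simp_all add: complex_eq_iff Re_divide Im_divide)
    then show ?thesis
      by (simp add: f_def cvec_def vec_eq_iff mult.commute)
  qed
  have f_exp: "f (of_real (exp (- s))) = ?z"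
  proof -
    have "(of_real (exp (- s)) + 1 / of_real (exp (- s))) / 2 = complex_of_real (cosh s)"
      by (simp add: cosh_def exp_minus field_simps)
    moreover have "(of_real (exp (- s)) - 1 / of_real (exp (- s))) / (2 * \<i>) = \<i> * complex_of_real (sinh s)"
      by (simp add: sinh_def exp_minus field_simps)
    ultimately show ?thesis
      by (simp add: f_def cvec_def vec_eq_iff mult.commute)
  qed
  have "log_abs (p ?z) / ereal (real n) \<le> ereal s"
    if n: "n \<ge> 1" and p: "polynomial_upto n p" and norm: "sup_norm (cvec ` K) p \<le> 1" for n p
  proof (cases "p ?z = 0")
    case True
    then show ?thesis
      using n by (simp add: log_abs_def)
  next
    case False
    obtain e where e: "\<And>z. p z = (\<Sum>\<alpha>\<in>monomials_upto n. e \<alpha> * (\<Prod>i\<in>UNIV. (z $ i) ^ \<alpha> i))"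
      using p unfolding polynomial_upto_def by metis
    \<comment> \<open>This form of \<open>\<zeta> ^ n * p (f \<zeta>)\<close> contains no division
      by \<open>\<zeta>\<close> and is therefore entire; the exponent
      \<open>n - (\<Sum>i\<in>UNIV. \<alpha> i)\<close> is not truncated, as \<open>\<alpha>\<close>
      has degree at most \<open>n\<close>.\<close>
    define G where "G \<zeta> = (\<Sum>\<alpha>\<in>monomials_upto n. e \<alpha> * (\<zeta> ^ (n - (\<Sum>i\<in>UNIV. \<alpha> i)) * (\<Prod>i\<in>UNIV. q i \<zeta> ^ \<alpha> i)))" for \<zeta>
    have G: "G \<zeta> = \<zeta> ^ n * p (f \<zeta>)" if "\<zeta> \<noteq> 0" for \<zeta>
    proof -
      have "\<zeta> ^ (n - (\<Sum>i\<in>UNIV. \<alpha> i)) * (\<Prod>i\<in>UNIV. q i \<zeta> ^ \<alpha> i) = \<zeta> ^ n * (\<Prod>i\<in>UNIV. (f \<zeta> $ i) ^ \<alpha> i)"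
        if "\<alpha> \<in> monomials_upto n" for \<alpha>
      proof -
        have "(\<Prod>i\<in>UNIV. q i \<zeta> ^ \<alpha> i) = \<zeta> ^ (\<Sum>i\<in>UNIV. \<alpha> i) * (\<Prod>i\<in>UNIV. (f \<zeta> $ i) ^ \<alpha> i)"
          by (simp add: qf[OF \<open>\<zeta> \<noteq> 0\<close>] power_mult_distrib prod.distrib power_sum)
        moreover have "\<zeta> ^ (n - (\<Sum>i\<in>UNIV. \<alpha> i)) * \<zeta> ^ (\<Sum>i\<in>UNIV. \<alpha> i) = \<zeta> ^ n"
          using that by (simp add: monomials_upto_def flip: power_add)
        ultimately show ?thesis
          by (metis mult.assoc)
      qed
      then show ?thesis
        by (simp add: G_def e sum_distrib_left mult.left_commute)
    qed
    have "cmod (G (of_real (exp (- s)))) \<le> 1"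
    proof (rule maximum_modulus_frontier[of G "cball 0 1"])
      have "G holomorphic_on UNIV"
        unfolding G_def q_def by (intro holomorphic_intros) auto
      then show "G holomorphic_on interior (cball 0 1)" "continuous_on (closure (cball 0 1)) G"
        by (auto intro: holomorphic_on_subset holomorphic_on_imp_continuous_on)
      show "cmod (G \<zeta>) \<le> 1" if "\<zeta> \<in> frontier (cball 0 1)" for \<zeta>
      proof -
        have "cmod \<zeta> = 1"
          using that by simp
        then have \<zeta>: "\<zeta> = cis (Arg \<zeta>)" "\<zeta> \<noteq> 0"
          using rcis_cmod_Arg[of \<zeta>] by (auto simp: rcis_def)
        then have "f \<zeta> \<in> cvec ` K"
          using f_cis ellipse by (metis imageI)
        then have "ereal (cmod (p (f \<zeta>))) \<le> sup_norm (cvec ` K) p"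
          unfolding sup_norm_def by (rule SUP_upper)
        then have "ereal (cmod (p (f \<zeta>))) \<le> 1"
          using norm by (rule order_trans)
        then show ?thesis
          using \<open>cmod \<zeta> = 1\<close> \<zeta>(2) by (simp add: G norm_mult norm_power)
      qed
    qed (use assms(2) in auto)
    then have "exp (- s) ^ n * cmod (p ?z) \<le> 1"
      by (simp add: G f_exp norm_mult norm_power)
    then have "cmod (p ?z) \<le> exp (real n * s)"
      unfolding exp_of_nat_mult by (simp add: exp_minus field_simps)
    then have "ln (cmod (p ?z)) \<le> real n * s"
      using False ln_le_cancel_iff[of "cmod (p ?z)" "exp (real n * s)"] by simp
    then show ?thesis
      using False n by (simp add: log_abs_def divide_le_eq mult.commute)
  qed
  then show ?thesis
    using False unfolding siciak_def by (auto intro!: Sup_least)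
qed

lemma cos_sin_shift_period:
  obtains t' where "t' \<in> {-pi..<pi}" "cos t' = cos t" "sin t' = sin t"
proof -
  \<comment> \<open>Negating both values turns the representative in [0, 2 pi) into one in [-pi, pi)
    after subtracting \<open>pi\<close>.\<close>
  obtain s where "0 \<le> s" "s < 2 * pi" "- cos t = cos s" "- sin t = sin s"
    using sincos_total_2pi[of "- cos t" "- sin t"] by auto
  then show thesis
    using that[of "s - pi"] by (simp add: cos_diff sin_diff)
qed

lemma arsinh_le_self: "arsinh x \<le> x" if "x \<ge> 0" for x :: real
proof -
  have "0 - arsinh 0 \<le> x - arsinh x"
  proof (rule DERIV_nonneg_imp_nondecreasing[OF that])
    show "\<exists>d. ((\<lambda>x. x - arsinh x) has_real_derivative d) (at t) \<and> 0 \<le> d" for t :: real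
      by (intro exI[of _ "1 - 1 / sqrt (t\<^sup>2 + 1)"] conjI derivative_intros) (simp add: add_nonneg_pos)
  qed
  then show ?thesis
    by simp
qed

text \<open>The complexified ellipse passes through \<open>x + \<i> \<epsilon> y\<close> only up to
  the real shift \<open>(cosh s - 1) *\<^sub>R a\<close>, which is of second order in
  \<open>\<epsilon>\<close>. As \<open>x\<close> is interior, this shift can be absorbed at the cost
  of a factor \<open>l < 1\<close>, which finally tends to 1.\<close>

lemma siciak_deriv_le:
  fixes K :: "(real ^ 'n::finite) set"
  assumes K: "convex K" "x \<in> interior K" and "b > 0"
    and ellipse: "\<And>t. t \<in> {-pi..<pi} \<Longrightarrow> cos t *\<^sub>R a + (b * sin t) *\<^sub>R y + x - a \<in> K"
  shows "siciak_deriv K y x \<le> ereal (1 / b)"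
proof -
  have ellipse': "cos t *\<^sub>R a + (b * sin t) *\<^sub>R y + x - a \<in> K" for t
    using ellipse cos_sin_shift_period by metis
  have le: "siciak_deriv K y x \<le> ereal (1 / (l * b))" if l: "0 < l" "l < 1" for l
  proof -
    \<comment> \<open>Shrinking the ellipse towards \<open>x\<close> by the factor \<open>l\<close> leaves room to translate it, so that the
      complexified ellipse passes exactly through \<open>x + \<i> \<epsilon> y\<close>.
      The translated ellipse is \<open>(1 - l) X \<epsilon> + l e\<close> with \<open>e\<close> on the given ellipse.\<close>
    define X where "X \<epsilon> = x - (l * (sqrt ((\<epsilon> / (l * b))\<^sup>2 + 1) - 1) / (1 - l)) *\<^sub>R a" for \<epsilon>
    have "(X \<longlongrightarrow> X 0) (at_right 0)"
      unfolding X_def[abs_def] using l \<open>b > 0\<close> by (intro tendsto_intros) auto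
    then have "\<forall>\<^sub>F \<epsilon> in at_right 0. X \<epsilon> \<in> interior K"
      using K(2) by (elim topological_tendstoD) (simp_all add: X_def)
    then have "\<forall>\<^sub>F \<epsilon> in at_right 0. siciak (cvec ` K) (cvec x + (\<i> * complex_of_real \<epsilon>) *s cvec y) / ereal \<epsilon>
        \<le> ereal (1 / (l * b))"
      using eventually_at_right_less[of 0]
    proof eventually_elim
      case (elim \<epsilon>)
      \<comment> \<open>The imaginary half axis \<open>l * b * sinh s\<close> has to equal
        \<open>\<epsilon>\<close>.\<close>
      define s where "s = arsinh (\<epsilon> / (l * b))"
      have s: "0 \<le> s" "s \<le> \<epsilon> / (l * b)"
        using elim(2) l \<open>b > 0\<close> sinh_real_nonneg_iff[of s] by (simp_all add: s_def arsinh_le_self del: sinh_real_nonneg_iff)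
      have sinh: "l * b * sinh s = \<epsilon>" and cosh: "cosh s = sqrt ((\<epsilon> / (l * b))\<^sup>2 + 1)"
        using l \<open>b > 0\<close> by (simp_all add: s_def cosh_arsinh_real)
      have "x - (l * cosh s) *\<^sub>R a + cos t *\<^sub>R (l *\<^sub>R a) + sin t *\<^sub>R ((l * b) *\<^sub>R y) \<in> K" for t
      proof -
        have "(1 - l) *\<^sub>R X \<epsilon> + l *\<^sub>R (cos t *\<^sub>R a + (b * sin t) *\<^sub>R y + x - a) \<in> K"
          using K(1) elim(1) interior_subset[of K] ellipse' l by (intro convexD) auto
        also have "(1 - l) *\<^sub>R X \<epsilon> = (1 - l) *\<^sub>R x - (l * (cosh s - 1)) *\<^sub>R a"
          using l by (simp add: X_def cosh scaleR_diff_right)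
        also have "\<dots> + l *\<^sub>R (cos t *\<^sub>R a + (b * sin t) *\<^sub>R y + x - a) =
          x - (l * cosh s) *\<^sub>R a + cos t *\<^sub>R (l *\<^sub>R a) + sin t *\<^sub>R ((l * b) *\<^sub>R y)"
          by (simp add: algebra_simps)
        finally show ?thesis .
      qed
      then have "siciak (cvec ` K) (cvec (x - (l * cosh s) *\<^sub>R a) + of_real (cosh s) *s cvec (l *\<^sub>R a)
          + (\<i> * of_real (sinh s)) *s cvec ((l * b) *\<^sub>R y)) \<le> ereal s"
        using s(1) by (rule siciak_le_on_ellipse)
      also have "cvec (x - (l * cosh s) *\<^sub>R a) + of_real (cosh s) *s cvec (l *\<^sub>R a)
          + (\<i> * of_real (sinh s)) *s cvec ((l * b) *\<^sub>R y) = cvec x + (\<i> * complex_of_real \<epsilon>) *s cvec y"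
        unfolding sinh[symmetric] by (simp add: cvec_def vec_eq_iff algebra_simps)
      finally have "siciak (cvec ` K) (cvec x + (\<i> * complex_of_real \<epsilon>) *s cvec y) / ereal \<epsilon> \<le> ereal s / ereal \<epsilon>"
        using elim(2) by (intro ereal_divide_right_mono) auto
      also have "\<dots> \<le> ereal (1 / (l * b))"
        using s(2) elim(2) by (simp add: divide_le_eq)
      finally show ?case .
    qed
    then show ?thesis
      unfolding siciak_deriv_def by (intro Liminf_le) auto
  qed
  have "((\<lambda>l. ereal (1 / (l * b))) \<longlongrightarrow> ereal (1 / (1 * b))) (at_left 1)"
    using \<open>b > 0\<close> by (intro tendsto_intros) auto
  moreover have "\<forall>\<^sub>F l in at_left 1. siciak_deriv K y x \<le> ereal (1 / (l * b))"
    by (rule eventually_mono[OF eventually_at_left_real[of 0 1]]) (auto intro: le)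
  ultimately show ?thesis
    using tendsto_lowerbound[of "\<lambda>l. ereal (1 / (l * b))" "ereal (1 / (1 * b))" "at_left 1"] by simp
qed

subsection \<open>Inscribed ellipses of the simplex\<close>

text \<open>In the half angle the expression is the perfect square
  \<open>(x * p + e * q)\<^sup>2 / x\<close>. The amplitude is the solution \<open>A\<close> of
  \<open>(x - A)\<^sup>2 = A\<^sup>2 + e\<^sup>2\<close>, for which the minimum over
  \<open>t\<close> is exactly 0.\<close>

lemma ellipse_ineq:
  fixes x e t :: real
  assumes "x > 0"
  shows "0 \<le> cos t * ((x\<^sup>2 - e\<^sup>2) / (2 * x)) + e * sin t + x - (x\<^sup>2 - e\<^sup>2) / (2 * x)"
proof -
  define p q where "p = cos (t / 2)" and "q = sin (t / 2)"
  have ct: "cos t = 1 - 2 * q\<^sup>2" and st: "sin t = 2 * p * q" and pq: "p\<^sup>2 = 1 - q\<^sup>2"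
    using cos_double_sin[of "t / 2"] sin_double[of "t / 2"] by (simp_all add: p_def q_def cos_squared_eq)
  have "cos t * ((x\<^sup>2 - e\<^sup>2) / (2 * x)) + e * sin t + x - (x\<^sup>2 - e\<^sup>2) / (2 * x)
    = x + 2 * e * p * q - q\<^sup>2 * ((x\<^sup>2 - e\<^sup>2) / x)"
    unfolding ct st using assms by (simp add: field_simps)
  also have "\<dots> = (x\<^sup>2 * p\<^sup>2 + 2 * e * p * q * x + e\<^sup>2 * q\<^sup>2) / x"
    unfolding pq using assms by (simp add: field_simps power2_eq_square)
  also have "\<dots> = (x * p + e * q)\<^sup>2 / x"
    by (simp add: power2_sum power_mult_distrib algebra_simps)
  finally have "cos t * ((x\<^sup>2 - e\<^sup>2) / (2 * x)) + e * sin t + x - (x\<^sup>2 - e\<^sup>2) / (2 * x)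
    = (x * p + e * q)\<^sup>2 / x" .
  then show ?thesis
    using assms by simp
qed

lemma std_simplex_ellipse:
  fixes x y :: "real ^ 'n::finite"
  assumes x: "\<And>j. barycentric x j > 0"
    and b: "b\<^sup>2 * (\<Sum>j\<in>UNIV. (barycentric_dir y j)\<^sup>2 / barycentric x j) = 1"
  obtains a where "\<And>t. cos t *\<^sub>R a + (b * sin t) *\<^sub>R y + x - a \<in> std_simplex"
proof
  \<comment> \<open>With these amplitudes the ellipse touches every facet of the simplex.\<close>
  define A where "A j = ((barycentric x j)\<^sup>2 - (b * barycentric_dir y j)\<^sup>2) / (2 * barycentric x j)" for j
  define a :: "real ^ 'n" where "a = (\<chi> i. A (Some i))"
  have "A j = (barycentric x j - b\<^sup>2 * ((barycentric_dir y j)\<^sup>2 / barycentric x j)) / 2" for j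
    using x[of j] by (simp add: A_def field_simps power2_eq_square)
  then have "(\<Sum>j\<in>UNIV. A j) = ((\<Sum>j\<in>UNIV. barycentric x j)
      - b\<^sup>2 * (\<Sum>j\<in>UNIV. (barycentric_dir y j)\<^sup>2 / barycentric x j)) / 2"
    by (simp only: sum_subtractf sum_distrib_left flip: sum_divide_distrib)
  \<comment> \<open>The condition on \<open>b\<close> says exactly that the amplitudes sum to 0, so
    that they are the coordinates of a single direction \<open>a\<close>.\<close>
  then have "(\<Sum>j\<in>UNIV. A j) = 0"
    by (simp add: b sum_barycentric)
  then have A: "barycentric_dir a j = A j" for j
    by (cases j) (auto simp: sum_UNIV_option barycentric_dir_def a_def)
  show "cos t *\<^sub>R a + (b * sin t) *\<^sub>R y + x - a \<in> std_simplex" for t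
    unfolding std_simplex_iff
  proof
    fix j
    have "cos t *\<^sub>R a + (b * sin t) *\<^sub>R y + x - a = x + (cos t *\<^sub>R a + (b * sin t) *\<^sub>R y - a)"
      by simp
    then have "barycentric (cos t *\<^sub>R a + (b * sin t) *\<^sub>R y + x - a) j =
        barycentric x j + barycentric_dir (cos t *\<^sub>R a + (b * sin t) *\<^sub>R y - a) j"
      by (metis barycentric_add)
    also have "barycentric_dir (cos t *\<^sub>R a + (b * sin t) *\<^sub>R y - a) j =
        cos t * barycentric_dir a j + b * sin t * barycentric_dir y j - barycentric_dir a j"
      by (cases j) (simp_all add: barycentric_dir_def sum.distrib sum_subtractf sum_distrib_left)
    finally show "0 \<le> barycentric (cos t *\<^sub>R a + (b * sin t) *\<^sub>R y + x - a) j"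
      using ellipse_ineq[OF x[of j], of t "b * barycentric_dir y j"] by (simp add: A A_def algebra_simps)
  qed
qed

theorem corollary11:
  fixes x y :: "real ^ 'n::finite"
  assumes "x \<in> interior std_simplex"
    and "norm y = 1"
  shows "siciak_deriv std_simplex y x = 1 / best_ellipse std_simplex x y \<and>
    (\<forall>(n::nat) (p :: real ^ 'n \<Rightarrow> real). polynomial_upto n p \<longrightarrow>
       ereal (real n) * siciak_deriv std_simplex y x *
         ereal (sqrt ((real_of_ereal (sup_norm std_simplex p))\<^sup>2 - (p x)\<^sup>2)) =
       ereal (real n) / best_ellipse std_simplex x y *
         ereal (sqrt ((real_of_ereal (sup_norm std_simplex p))\<^sup>2 - (p x)\<^sup>2)))"
proof -
  define S where "S = (\<Sum>j\<in>UNIV. (barycentric_dir y j)\<^sup>2 / barycentric x j)"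
  have "y \<noteq> 0"
    using assms(2) by auto
  note x = barycentric_pos_of_interior[OF assms(1)]
  have S: "S > 0" and ge: "ereal (sqrt S) \<le> siciak_deriv std_simplex y x"
    unfolding S_def by (rule siciak_deriv_std_simplex_ge[OF x \<open>y \<noteq> 0\<close>])+
  note le = siciak_deriv_le[OF convex_std_simplex assms(1)]
  have "(1 / sqrt S)\<^sup>2 * S = 1"
    using S by (simp add: power_divide)
  then obtain a where a: "\<And>t. cos t *\<^sub>R a + (1 / sqrt S * sin t) *\<^sub>R y + x - a \<in> std_simplex"
    using std_simplex_ellipse[OF x, where b = "1 / sqrt S" and y = y] unfolding S_def by blast
  \<comment> \<open>The explicit ellipse gives an upper bound that meets the lower bound
    \<open>ge\<close>.\<close>
  have "siciak_deriv std_simplex y x \<le> ereal (1 / (1 / sqrt S))"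
    by (rule le[OF _ a]) (use S in simp)
  with ge have D: "siciak_deriv std_simplex y x = ereal (sqrt S)"
    by simp
  \<comment> \<open>No inscribed ellipse can be better: \<open>b > 0\<close> would give
    \<open>sqrt S \<le> 1 / b\<close> through the derivative computed in \<open>D\<close>.\<close>
  have E: "best_ellipse std_simplex x y = ereal (1 / sqrt S)"
    unfolding best_ellipse_def
  proof (rule Sup_eqI)
    show "c \<le> ereal (1 / sqrt S)"
      if "c \<in> {ereal b |b. \<exists>a. \<forall>t\<in>{-pi..<pi}. cos t *\<^sub>R a + (b * sin t) *\<^sub>R y + x - a \<in> std_simplex}" for c
    proof -
      obtain b a where c: "c = ereal b" and
        ba: "\<And>t. t \<in> {-pi..<pi} \<Longrightarrow> cos t *\<^sub>R a + (b * sin t) *\<^sub>R y + x - a \<in> std_simplex"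
        using \<open>c \<in> _\<close> by blast
      show ?thesis
      proof (cases "b > 0")
        case True
        then have "siciak_deriv std_simplex y x \<le> ereal (1 / b)"
          using ba by (rule le)
        then have "sqrt S \<le> 1 / b"
          unfolding D by simp
        then have "sqrt S * b \<le> 1"
          unfolding pos_le_divide_eq[OF True] .
        moreover have "sqrt S > 0"
          using S by simp
        ultimately have "b \<le> 1 / sqrt S"
          by (simp only: pos_le_divide_eq mult.commute)
        then show ?thesis
          by (simp add: c)
      next
        case False
        moreover have "0 \<le> 1 / sqrt S"
          using S by simp
        ultimately have "b \<le> 1 / sqrt S"
          by linarith
        then show ?thesis
          by (simp add: c)
      qed
    qed
    show "ereal (1 / sqrt S) \<le> c"
      if "\<And>c'. c' \<in> {ereal b |b. \<exists>a. \<forall>t\<in>{-pi..<pi}. cos t *\<^sub>R a + (b * sin t) *\<^sub>R y + x - a \<in> std_simplex}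
        \<Longrightarrow> c' \<le> c" for c
      by (rule that) (use a in blast)
  qed
  show ?thesis
    using S by (simp add: D E one_ereal_def)
qed

end
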